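(* Let $\mathcal V^u_{W\dot W}$ be a USG and let $\mathcal V_{W\dot W}$ be a genop such that $\mathcal V_{W\dot W}\subseteq\mathcal V^u_{W\dot W}$ and $\mathcal V_{W\dot W}\circ W=\mathcal V^u_{W\dot W}\circ W$. Let $\mathcal V_W$ be invariant in $\mathcal V^u_{W\dot W}$. Let $p,p_1,p_2$ be polynomials over $\mathbb F$. Then 1. $\mathcal V^u_{W\dot W}+(\mathcal V_W)_{\dot W}=\mathcal V_{W\dot W}+(\mathcal V_W\oplus(\mathcal V_W)_{\dot W})$, and this space is a genop. 2. $\mathcal V_W$ is invariant in $\mathcal V_{W\dot W}$, and therefore $\mathcal V_{W\dot W}\cap\mathcal V_W=\mathcal V_{W\dot W}\cap(\mathcal V_W\oplus(\mathcal V_W)_{\dot W})$ and $\mathcal V_{W\dot W}\cap\mathcal V_W$ is a genop. 3. $p(\mathcal V^u_{W\dot W}+(\mathcal V_W)_{\dot W})=p(\mathcal V_{W\dot W})+(\mathcal V_W\oplus(\mathcal V_W)_{\dot W})$. 4. $p(\mathcal V_{W\dot W}\cap\mathcal V_W)=p(\mathcal V_{W\dot W})\cap\mathcal V_W=p(\mathcal V_{W\dot W})\cap(\mathcal V_W\oplus(\mathcal V_W)_{\dot W})$. 5. If $p(\mathcal V_{W\dot W})$ is decoupled, so are $p(\mathcal V^u_{W\dot W}+(\mathcal V_W)_{\dot W})$ and $p(\mathcal V_{W\dot W}\cap\mathcal V_W)$. 6. If $p_1(\mathcal V^u_{W\dot W}+(\mathcal V_W)_{\dot W})$ and $p_2(\mathcal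 V_{W\dot W}\cap\mathcal V_W)$ are decoupled, then $(p_1p_2)(\mathcal V_{W\dot W})$ is decoupled.
   Context: Fix a field $\mathbb F$; all index sets are finite. A vector on $X$ is a function $X\to\mathbb F$. $W,\dot W$ are disjoint sets that are copies of each other (in bijection); subscripts such as $(\mathcal V_W)_{\dot W}$, $(\mathcal V_{W\dot W})_{WW_1}$ denote relabelling of index sets along bijections. A genaut $\mathcal V_{W\dot W}$ is a linear subspace of vectors $(f_W,g_{\dot W})$ on $W\uplus\dot W$. For spaces on different index sets: $\mathcal V_X+\mathcal V_Y$ is on $X\cup Y$, formed after extending vectors by zero (so $\mathcal V_{W\dot W}+(\mathcal V_W)_{\dot W}=\mathcal V_{W\dot W}+(0_W\oplus(\mathcal V_W)_{\dot W})$); $\mathcal V_X\cap\mathcal V_Y$ is the set of vectors on $X\cup Y$ whose restrictions to $X$, $Y$ lie in $\mathcal V_X$, $\mathcal V_Y$ (so $\mathcal V_{W\dot W}\cap\mathcal V_W=\{(f_W,g_{\dot W})\in\mathcal V_{W\dot W}:f_W\in\mathcal V_W\}$). $\mathcal V_{XY}\circ X:=\{f_X:(f_X,g_Y)\in\mathcal V_{XY}\text{ for some }g_Y\}$, $\mathcal V_{XY}\times X:=\{f_X:(f_X,0_Y)\in\mathcal V_{XY}\}$, $\mathcal V_{XY}\leftrightarrow\mathcal V_{YZ}:=\{(f_X,h_Z):\exists g_Y,(f_X,g_Y)\in\mathcal V_{XY},(g_Y,h_Z)\in\mathcal V_{YZ}\}$ (also with $Z$ empty). A genaut is a USG if $\mathcal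 V_{W\dot W}\circ W\supseteq(\mathcal V_{W\dot W}\circ\dot W)_W$; an LSG if $\mathcal V_{W\dot W}\times W\supseteq(\mathcal V_{W\dot W}\times\dot W)_W$; a genop if both. $\mathcal V_W$ is invariant in $\mathcal V_{W\dot W}$ iff it is conditioned invariant, $\mathcal V_{W\dot W}\leftrightarrow\mathcal V_W\subseteq(\mathcal V_W)_{\dot W}$, and controlled invariant, $\mathcal V_{W\dot W}\leftrightarrow(\mathcal V_W)_{\dot W}\supseteq\mathcal V_W$. A space on $W\uplus\dot W$ is decoupled if it has the form $\mathcal V^1_W\oplus\mathcal V^2_{\dot W}$. Polynomials of genauts: $\mathcal V^1_{W\dot W}+_{\dot w}\mathcal V^2_{W\dot W}:=\{(f_W,g^1_{\dot W}+g^2_{\dot W}):(f_W,g^i_{\dot W})\in\mathcal V^i_{W\dot W}\}$; $\lambda^{\dot w}\mathcal V_{W\dot W}:=\{(f_W,\lambda g_{\dot W}):(f_W,g_{\dot W})\in\mathcal V_{W\dot W}\}+(0_W\oplus\mathcal V_{W\dot W}\times\dot W)$; $\mathcal V^1_{W\dot W}*\mathcal V^2_{W\dot W}:=(\mathcal V^1_{W\dot W})_{WW_1}\leftrightarrow(\mathcal V^2_{W\dot W})_{W_1\dot W}$ with $W_1$ a disjoint dummy copy of $W$; $\mathcal V^{(0)}_{W\dot W}:=I_{W\dot W}+_{\dot w}[\mathcal V_{W\dot W}\circ W\oplus\mathcal V_{W\dot W}\times\dot W]$ with $I_{W\dot W}=\{(f_W,f_{\dot W})\}$ ($f_{\dot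 W}$ the copy of $f_W$); $\mathcal V^{(1)}_{W\dot W}:=\mathcal V_{W\dot W}$; $\mathcal V^{(k)}_{W\dot W}:=\mathcal V^{(k-1)}_{W\dot W}*\mathcal V_{W\dot W}$. For $p(s)=\sum_{i=0}^n\alpha_is^i$, $p(\mathcal V_{W\dot W}):=\alpha_0^{\dot w}\mathcal V^{(0)}_{W\dot W}+_{\dot w}\cdots+_{\dot w}\alpha_n^{\dot w}\mathcal V^{(n)}_{W\dot W}$. *)

theory Defs
  imports
    "HOL-Computational_Algebra.Polynomial"
    "HOL-Library.Function_Algebras"
    "HOL-Library.Product_Plus"
    "HOL-Library.Set_Algebras"
begin

text \<open>
  A vector on an index set \<open>X\<close> is represented by a function on the ambient type that is \<open>0\<close>
  outside \<open>X\<close>, so that equality of vectors is equality of functions.  The copy of \<open>W\<close> is never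
  materialised: a vector \<open>(f, g)\<close> on the disjoint union of \<open>W\<close> and its copy is a pair, whose second
  component is indexed by \<open>W\<close> itself.  All relabellings between \<open>W\<close> and its copies thereby become
  the identity, and a direct sum is the product set \<open>A \<times> B\<close>.
\<close>

definition vectors_on :: "'x set \<Rightarrow> ('x \<Rightarrow> 'a::field) set" where
  "vectors_on X = {f. \<forall>x. x \<notin> X \<longrightarrow> f x = 0}"

definition vscale :: "'a::field \<Rightarrow> ('x \<Rightarrow> 'a) \<Rightarrow> 'x \<Rightarrow> 'a" where
  "vscale c f = (\<lambda>x. c * f x)"

definition pscale :: "'a::field \<Rightarrow> ('x \<Rightarrow> 'a) \<times> ('y \<Rightarrow> 'a) \<Rightarrow> ('x \<Rightarrow> 'a) \<times> ('y \<Rightarrow> 'a)" where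
  "pscale c v = (vscale c (fst v), vscale c (snd v))"

global_interpretation vec: vector_space vscale
  by unfold_locales (auto simp: vscale_def fun_eq_iff algebra_simps)

global_interpretation pair: vector_space pscale
  by unfold_locales
    (auto simp: pscale_def vscale_def fun_eq_iff prod_eq_iff algebra_simps)

definition space_on :: "'x set \<Rightarrow> ('x \<Rightarrow> 'a::field) set \<Rightarrow> bool" where
  "space_on X U \<longleftrightarrow> U \<subseteq> vectors_on X \<and> vec.subspace U"

type_synonym ('w, 'a) genaut = "(('w \<Rightarrow> 'a) \<times> ('w \<Rightarrow> 'a)) set"

definition is_genaut :: "'w set \<Rightarrow> ('w, 'a::field) genaut \<Rightarrow> bool" where
  "is_genaut W V \<longleftrightarrow> V \<subseteq> vectors_on W \<times> vectors_on W \<and> pair.subspace V"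

text \<open>
  The suffixes \<open>l\<close> and \<open>r\<close> select the left and right index set of a space on a disjoint union.
\<close>

definition restrict_l :: "(('x \<Rightarrow> 'a) \<times> ('y \<Rightarrow> 'a::field)) set \<Rightarrow> ('x \<Rightarrow> 'a) set" where
  "restrict_l V = {f. \<exists>g. (f, g) \<in> V}"

definition restrict_r :: "(('x \<Rightarrow> 'a) \<times> ('y \<Rightarrow> 'a::field)) set \<Rightarrow> ('y \<Rightarrow> 'a) set" where
  "restrict_r V = {g. \<exists>f. (f, g) \<in> V}"

definition contract_l :: "(('x \<Rightarrow> 'a) \<times> ('y \<Rightarrow> 'a::field)) set \<Rightarrow> ('x \<Rightarrow> 'a) set" where
  "contract_l V = {f. (f, 0) \<in> V}"

definition contract_r :: "(('x \<Rightarrow> 'a) \<times> ('y \<Rightarrow> 'a::field)) set \<Rightarrow> ('y \<Rightarrow> 'a) set" where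
  "contract_r V = {g. (0, g) \<in> V}"

text \<open>
  The matched composition \<open>V \<leftrightarrow> V'\<close>, followed by its two special cases in which the second space
  lives only on the left, respectively only on the right, index set of the first.
\<close>

definition matched ::
  "(('x \<Rightarrow> 'a) \<times> ('y \<Rightarrow> 'a::field)) set \<Rightarrow> (('y \<Rightarrow> 'a) \<times> ('z \<Rightarrow> 'a)) set
    \<Rightarrow> (('x \<Rightarrow> 'a) \<times> ('z \<Rightarrow> 'a)) set" where
  "matched V V' = {(f, h). \<exists>g. (f, g) \<in> V \<and> (g, h) \<in> V'}"

definition matched_l ::
  "(('x \<Rightarrow> 'a) \<times> ('y \<Rightarrow> 'a::field)) set \<Rightarrow> ('x \<Rightarrow> 'a) set \<Rightarrow> ('y \<Rightarrow> 'a) set" where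
  "matched_l V U = {g. \<exists>f. (f, g) \<in> V \<and> f \<in> U}"

definition matched_r ::
  "(('x \<Rightarrow> 'a) \<times> ('y \<Rightarrow> 'a::field)) set \<Rightarrow> ('y \<Rightarrow> 'a) set \<Rightarrow> ('x \<Rightarrow> 'a) set" where
  "matched_r V U = {f. \<exists>g. (f, g) \<in> V \<and> g \<in> U}"

definition usg :: "'w set \<Rightarrow> ('w, 'a::field) genaut \<Rightarrow> bool" where
  "usg W V \<longleftrightarrow> is_genaut W V \<and> restrict_r V \<subseteq> restrict_l V"

definition lsg :: "'w set \<Rightarrow> ('w, 'a::field) genaut \<Rightarrow> bool" where
  "lsg W V \<longleftrightarrow> is_genaut W V \<and> contract_r V \<subseteq> contract_l V"

definition genop :: "'w set \<Rightarrow> ('w, 'a::field) genaut \<Rightarrow> bool" where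
  "genop W V \<longleftrightarrow> usg W V \<and> lsg W V"

definition conditioned_invariant :: "('w \<Rightarrow> 'a::field) set \<Rightarrow> ('w, 'a) genaut \<Rightarrow> bool" where
  "conditioned_invariant U V \<longleftrightarrow> matched_l V U \<subseteq> U"

definition controlled_invariant :: "('w \<Rightarrow> 'a::field) set \<Rightarrow> ('w, 'a) genaut \<Rightarrow> bool" where
  "controlled_invariant U V \<longleftrightarrow> U \<subseteq> matched_r V U"

definition invariant_in :: "('w \<Rightarrow> 'a::field) set \<Rightarrow> ('w, 'a) genaut \<Rightarrow> bool" where
  "invariant_in U V \<longleftrightarrow> conditioned_invariant U V \<and> controlled_invariant U V"

definition decoupled :: "'w set \<Rightarrow> ('w, 'a::field) genaut \<Rightarrow> bool" where
  "decoupled W V \<longleftrightarrow> (\<exists>U1 U2. space_on W U1 \<and> space_on W U2 \<and> V = U1 \<times> U2)"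

text \<open>
  Sum with a space on the right index set (extended by zero), and intersection with a space on the
  left index set.  For spaces on the same index set these operations are the set sum \<open>+\<close> and \<open>\<inter>\<close>.
\<close>

definition sum_r :: "('w, 'a::field) genaut \<Rightarrow> ('w \<Rightarrow> 'a) set \<Rightarrow> ('w, 'a) genaut" where
  "sum_r V U = V + {0} \<times> U"

definition inter_l :: "('w, 'a::field) genaut \<Rightarrow> ('w \<Rightarrow> 'a) set \<Rightarrow> ('w, 'a) genaut" where
  "inter_l V U = {(f, g). (f, g) \<in> V \<and> f \<in> U}"

text \<open>
  The operations \<open>+\<close> and \<open>\<lambda>\<close> decorated with a dotted letter, which act on the right component only.
\<close>

definition dot_add :: "('w, 'a::field) genaut \<Rightarrow> ('w, 'a) genaut \<Rightarrow> ('w, 'a) genaut" where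
  "dot_add V1 V2 = {(f, g1 + g2) | f g1 g2. (f, g1) \<in> V1 \<and> (f, g2) \<in> V2}"

definition dot_scale :: "'a::field \<Rightarrow> ('w, 'a) genaut \<Rightarrow> ('w, 'a) genaut" where
  "dot_scale c V = {(f, vscale c g) | f g. (f, g) \<in> V} + {0} \<times> contract_r V"

definition genaut_id :: "'w set \<Rightarrow> ('w, 'a::field) genaut" where
  "genaut_id W = {(f, f) | f. f \<in> vectors_on W}"

text \<open>
  In \<open>V * V'\<close> the intermediate dummy copy of \<open>W\<close> is the shared middle component of \<open>matched\<close>.
\<close>

definition genaut_mult :: "('w, 'a::field) genaut \<Rightarrow> ('w, 'a) genaut \<Rightarrow> ('w, 'a) genaut" where
  "genaut_mult V V' = matched V V'"

text \<open>
  The zeroth power is not a neutral element for \<open>genaut_mult\<close> in general, so the first power has to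
  be a base case of its own.
\<close>

fun genaut_power :: "'w set \<Rightarrow> ('w, 'a::field) genaut \<Rightarrow> nat \<Rightarrow> ('w, 'a) genaut" where
  "genaut_power W V 0 = dot_add (genaut_id W) (restrict_l V \<times> contract_r V)"
| "genaut_power W V (Suc 0) = V"
| "genaut_power W V (Suc (Suc k)) = genaut_mult (genaut_power W V (Suc k)) V"

primrec genaut_poly_upto ::
  "'w set \<Rightarrow> 'a::field poly \<Rightarrow> ('w, 'a) genaut \<Rightarrow> nat \<Rightarrow> ('w, 'a) genaut" where
  "genaut_poly_upto W p V 0 = dot_scale (coeff p 0) (genaut_power W V 0)"
| "genaut_poly_upto W p V (Suc n) =
    dot_add (genaut_poly_upto W p V n) (dot_scale (coeff p (Suc n)) (genaut_power W V (Suc n)))"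

text \<open>
  The number of summands is taken from \<open>degree p\<close>.  For arbitrary genauts a summand with coefficient
  \<open>0\<close> may change the result, but not for genops, whose powers all have the same left restriction and
  the same right contraction.
\<close>

definition genaut_poly :: "'w set \<Rightarrow> 'a::field poly \<Rightarrow> ('w, 'a) genaut \<Rightarrow> ('w, 'a) genaut" where
  "genaut_poly W p V = genaut_poly_upto W p V (degree p)"

end

theory Submission
  imports Defs
begin

text \<open>
  A genop \<open>V\<close> with left restriction \<open>D\<close> and right contraction \<open>K\<close> is a linear operator on the
  quotient \<open>D / K\<close> in disguise: its two inclusions say that \<open>K \<subseteq> D\<close>, that right components lie in
  \<open>D\<close>, and that elements of \<open>K\<close> are related to \<open>0\<close>.  Choosing a linear map \<open>t\<close> with
  \<open>(f, t f) \<in> V\<close> for \<open>f \<in> D\<close> makes this concrete: \<open>V\<close> is the graph of \<open>t\<close> on \<open>D\<close> modulo \<open>K\<close>, and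
  \<open>t\<close> maps both \<open>D\<close> and \<open>K\<close> into themselves (\<open>genop_imp_graph_mod\<close>).

  Polynomials in such a graph are computed in the operator: the polynomial \<open>p\<close> of the graph of \<open>t\<close>
  on \<open>D\<close> modulo \<open>K\<close> is the graph of \<open>p(t)\<close> on \<open>D\<close> modulo \<open>K\<close> (\<open>genaut_poly_graph_mod\<close>).
  It is decoupled exactly when \<open>p(t)\<close> maps \<open>D\<close> into \<open>K\<close> (\<open>decoupled_graph_mod_iff\<close>).

  An invariant space \<open>U\<close> satisfies \<open>K \<subseteq> U \<subseteq> D\<close> and is mapped into itself by \<open>t\<close>.  The space
  \<open>sum_r Vu U\<close> is then the graph of the same \<open>t\<close> on \<open>D\<close> modulo \<open>U\<close>, and \<open>inter_l V U\<close> is the graph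
  of \<open>t\<close> on \<open>U\<close> modulo \<open>K\<close>: the operators induced on \<open>D / U\<close> and \<open>U / K\<close>.  All claims
  become statements about the chain \<open>K \<subseteq> U \<subseteq> D\<close>.  The last one, for example, says that if
  \<open>p1(t)\<close> maps \<open>D\<close> into \<open>U\<close> and \<open>p2(t)\<close> maps \<open>U\<close> into \<open>K\<close>, then their product maps \<open>D\<close> into \<open>K\<close>.
\<close>

section \<open>Polynomials in a linear operator\<close>

global_interpretation vec_pair: vector_space_pair vscale vscale ..

definition poly_op :: "'a::field poly \<Rightarrow> (('w \<Rightarrow> 'a) \<Rightarrow> 'w \<Rightarrow> 'a) \<Rightarrow> ('w \<Rightarrow> 'a) \<Rightarrow> 'w \<Rightarrow> 'a" where
  "poly_op p t f = (\<Sum>i\<le>degree p. vscale (coeff p i) ((t ^^ i) f))"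

lemma poly_op_bound:
  assumes "degree p \<le> n"
  shows "poly_op p t f = (\<Sum>i\<le>n. vscale (coeff p i) ((t ^^ i) f))"
  unfolding poly_op_def using assms
  by (intro sum.mono_neutral_left) (auto simp: coeff_eq_0)

lemma poly_op_0 [simp]: "poly_op 0 t f = 0"
  by (simp add: poly_op_def)

lemma poly_op_add: "poly_op (p + q) t f = poly_op p t f + poly_op q t f"
proof -
  define n where "n = max (degree p) (degree q)"
  have "degree p \<le> n" "degree q \<le> n" "degree (p + q) \<le> n"
    by (auto simp: n_def degree_add_le_max)
  then show ?thesis
    by (simp add: poly_op_bound vec.scale_left_distrib sum.distrib)
qed

lemma poly_op_smult: "poly_op (smult c p) t f = vscale c (poly_op p t f)"
  by (simp add: poly_op_bound[OF degree_smult_le] poly_op_bound[of p "degree p"] vec.scale_sum_right)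

lemma poly_op_pCons:
  assumes "Vector_Spaces.linear vscale vscale t"
  shows "poly_op (pCons a p) t f = vscale a f + t (poly_op p t f)"
proof -
  have "poly_op (pCons a p) t f =
      (\<Sum>i\<le>Suc (degree p). vscale (coeff (pCons a p) i) ((t ^^ i) f))"
    by (rule poly_op_bound[OF degree_pCons_le])
  also have "\<dots> = vscale a f + (\<Sum>i\<le>degree p. vscale (coeff p i) (t ((t ^^ i) f)))"
    by (subst sum.atMost_Suc_shift) simp
  also have "(\<Sum>i\<le>degree p. vscale (coeff p i) (t ((t ^^ i) f))) = t (poly_op p t f)"
    by (simp add: poly_op_def vec_pair.linear_sum[OF assms] vec_pair.linear_scale[OF assms])
  finally show ?thesis .
qed

lemma poly_op_mult:
  assumes "Vector_Spaces.linear vscale vscale t"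
  shows "poly_op (p * q) t f = poly_op p t (poly_op q t f)"
proof (induction p)
  case 0
  show ?case by simp
next
  case (pCons a p)
  then show ?case
    by (simp add: poly_op_add poly_op_smult poly_op_pCons[OF assms])
qed

lemma linear_funpow:
  fixes t :: "('w \<Rightarrow> 'a::field) \<Rightarrow> 'w \<Rightarrow> 'a"
  assumes "Vector_Spaces.linear vscale vscale t"
  shows "Vector_Spaces.linear vscale vscale (t ^^ n)"
proof (induction n)
  case 0
  show ?case by (simp only: funpow.simps vec.linear_id)
next
  case (Suc n)
  then show ?case using Vector_Spaces.linear_compose[OF Suc assms] by (simp add: comp_def)
qed

lemma linear_poly_op:
  assumes "Vector_Spaces.linear vscale vscale t"
  shows "Vector_Spaces.linear vscale vscale (poly_op p t)"
  unfolding poly_op_def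
  by (intro vec_pair.linear_compose_sum ballI vec_pair.linear_compose_scale_right
      linear_funpow assms)

lemma funpow_image_subset: "t ` S \<subseteq> S \<Longrightarrow> (t ^^ n) ` S \<subseteq> S"
  by (induction n) auto

lemma poly_op_image_subset:
  assumes "vec.subspace S" "t ` S \<subseteq> S"
  shows "poly_op p t ` S \<subseteq> S"
  unfolding poly_op_def using funpow_image_subset[OF assms(2)]
  by (auto intro!: vec.subspace_sum vec.subspace_scale assms(1))

section \<open>Operators modulo a subspace\<close>

definition graph_mod ::
  "(('w \<Rightarrow> 'a) \<Rightarrow> 'w \<Rightarrow> 'a::field) \<Rightarrow> ('w \<Rightarrow> 'a) set \<Rightarrow> ('w \<Rightarrow> 'a) set \<Rightarrow> ('w, 'a) genaut" where
  "graph_mod t D K = {(f, g). f \<in> D \<and> g - t f \<in> K}"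

text \<open>
  The data \<open>t, D, K\<close> for which \<open>graph_mod t D K\<close> describes an operator on \<open>D / K\<close>.
\<close>

locale induced_operator =
  fixes W :: "'w set"
    and t :: "('w \<Rightarrow> 'a::field) \<Rightarrow> 'w \<Rightarrow> 'a"
    and D K :: "('w \<Rightarrow> 'a) set"
  assumes space_D: "space_on W D"
    and space_K: "space_on W K"
    and K_subset_D: "K \<subseteq> D"
    and linear_t: "Vector_Spaces.linear vscale vscale t"
    and t_D: "t ` D \<subseteq> D"
    and t_K: "t ` K \<subseteq> K"
begin

lemma subspace_D: "vec.subspace D" and subspace_K: "vec.subspace K"
  using space_D space_K by (auto simp: space_on_def)

lemma induced_operator_poly_op: "induced_operator W (poly_op p t) D K"
  using poly_op_image_subset[OF subspace_D t_D] poly_op_image_subset[OF subspace_K t_K]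
    space_D space_K K_subset_D linear_poly_op[OF linear_t]
  by (intro induced_operator.intro)

lemma induced_operator_funpow: "induced_operator W (t ^^ n) D K"
  using funpow_image_subset[OF t_D] funpow_image_subset[OF t_K]
    space_D space_K K_subset_D linear_funpow[OF linear_t]
  by (intro induced_operator.intro)

lemma restrict_l_graph_mod: "restrict_l (graph_mod t D K) = D"
proof -
  have "(f, t f) \<in> graph_mod t D K" if "f \<in> D" for f
    using that vec.subspace_0[OF subspace_K] by (simp add: graph_mod_def)
  then have "D \<subseteq> restrict_l (graph_mod t D K)"
    unfolding restrict_l_def by blast
  then show ?thesis by (auto simp: restrict_l_def graph_mod_def)
qed

lemma contract_r_graph_mod: "contract_r (graph_mod t D K) = K"
  using vec.subspace_0[OF subspace_D]
  by (auto simp: contract_r_def graph_mod_def vec_pair.linear_0[OF linear_t])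

lemma graph_mod_right_in: "(f, g) \<in> graph_mod t D K \<Longrightarrow> g \<in> D"
proof -
  assume "(f, g) \<in> graph_mod t D K"
  then have "t f \<in> D" "g - t f \<in> D"
    using t_D K_subset_D by (auto simp: graph_mod_def)
  then show "g \<in> D"
    using vec.subspace_add[OF subspace_D] by fastforce
qed

lemma is_genaut_graph_mod: "is_genaut W (graph_mod t D K)"
proof -
  have "pair.subspace (graph_mod t D K)"
  proof (rule pair.subspaceI)
    show "0 \<in> graph_mod t D K"
      using vec.subspace_0[OF subspace_D] vec.subspace_0[OF subspace_K]
      by (simp add: graph_mod_def zero_prod_def vec_pair.linear_0[OF linear_t])
  next
    fix x y assume "x \<in> graph_mod t D K" "y \<in> graph_mod t D K"
    then have "fst x + fst y \<in> D" "(snd x - t (fst x)) + (snd y - t (fst y)) \<in> K"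
      using vec.subspace_add[OF subspace_D] vec.subspace_add[OF subspace_K]
      by (auto simp: graph_mod_def)
    then show "x + y \<in> graph_mod t D K"
      by (simp add: graph_mod_def plus_prod_def vec_pair.linear_add[OF linear_t] add_diff_add)
  next
    fix c x assume "x \<in> graph_mod t D K"
    then have "vscale c (fst x) \<in> D" "vscale c (snd x - t (fst x)) \<in> K"
      using vec.subspace_scale[OF subspace_D] vec.subspace_scale[OF subspace_K]
      by (auto simp: graph_mod_def)
    then show "pscale c x \<in> graph_mod t D K"
      by (simp add: graph_mod_def pscale_def vec_pair.linear_scale[OF linear_t]
          vec.scale_right_diff_distrib)
  qed
  moreover have "graph_mod t D K \<subseteq> vectors_on W \<times> vectors_on W"
    using graph_mod_right_in space_D by (auto simp: space_on_def graph_mod_def)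
  ultimately show ?thesis by (simp add: is_genaut_def)
qed

lemma genop_graph_mod: "genop W (graph_mod t D K)"
proof -
  have "restrict_r (graph_mod t D K) \<subseteq> D"
    using graph_mod_right_in by (auto simp: restrict_r_def)
  moreover have "K \<subseteq> contract_l (graph_mod t D K)"
    using K_subset_D t_K vec.subspace_neg[OF subspace_K]
    by (auto simp: contract_l_def graph_mod_def)
  ultimately show ?thesis
    using is_genaut_graph_mod restrict_l_graph_mod contract_r_graph_mod
    by (simp add: genop_def usg_def lsg_def)
qed

text \<open>
  A decoupled space containing \<open>(f, t f)\<close> and \<open>(0, 0)\<close> also contains \<open>(f, 0)\<close>.
\<close>

lemma decoupled_graph_mod_iff: "decoupled W (graph_mod t D K) \<longleftrightarrow> t ` D \<subseteq> K"
proof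
  assume "decoupled W (graph_mod t D K)"
  then obtain U1 U2 where U: "vec.subspace U2" "graph_mod t D K = U1 \<times> U2"
    by (auto simp: decoupled_def space_on_def)
  show "t ` D \<subseteq> K"
  proof (rule image_subsetI)
    fix f assume "f \<in> D"
    then have "(f, t f) \<in> U1 \<times> U2"
      using vec.subspace_0[OF subspace_K] by (simp add: graph_mod_def flip: U(2))
    then have "(f, 0) \<in> graph_mod t D K"
      using vec.subspace_0[OF U(1)] U(2) by auto
    then show "t f \<in> K"
      using vec.subspace_neg[OF subspace_K] by (fastforce simp: graph_mod_def)
  qed
next
  assume tDK: "t ` D \<subseteq> K"
  have "g - t f \<in> K \<longleftrightarrow> g \<in> K" if "f \<in> D" for f g
    using that tDK vec.subspace_add[OF subspace_K, of "g - t f" "t f"]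
      vec.subspace_diff[OF subspace_K] by auto
  then have "graph_mod t D K = D \<times> K"
    by (auto simp: graph_mod_def)
  then show "decoupled W (graph_mod t D K)"
    using space_D space_K by (auto simp: decoupled_def)
qed

end

text \<open>
  A basis of \<open>restrict_l V\<close> can be lifted to \<open>V\<close> element by element; linearity extends the choice.
\<close>

lemma linear_selection_exists:
  assumes "pair.subspace V"
  shows "\<exists>t. Vector_Spaces.linear vscale vscale t \<and> (\<forall>f\<in>restrict_l V. (f, t f) \<in> V)"
proof -
  obtain B where B: "B \<subseteq> restrict_l V" "vec.independent B" "restrict_l V \<subseteq> vec.span B"
    using vec.basis_exists by metis
  have "\<forall>b\<in>B. \<exists>g. (b, g) \<in> V"
    using B(1) by (auto simp: restrict_l_def)
  then obtain s where s: "\<And>b. b \<in> B \<Longrightarrow> (b, s b) \<in> V"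
    using bchoice[of B "\<lambda>b g. (b, g) \<in> V"] by auto
  obtain t where t: "Vector_Spaces.linear vscale vscale t" "\<And>b. b \<in> B \<Longrightarrow> t b = s b"
    using vec_pair.linear_independent_extend[OF B(2)] by metis
  have "vec.subspace {f. (f, t f) \<in> V}"
  proof (rule vec.subspaceI)
    show "0 \<in> {f. (f, t f) \<in> V}"
      using pair.subspace_0[OF assms] by (simp add: vec_pair.linear_0[OF t(1)] zero_prod_def)
  next
    fix x y assume "x \<in> {f. (f, t f) \<in> V}" "y \<in> {f. (f, t f) \<in> V}"
    then show "x + y \<in> {f. (f, t f) \<in> V}"
      using pair.subspace_add[OF assms, of "(x, t x)" "(y, t y)"]
      by (simp add: vec_pair.linear_add[OF t(1)])
  next
    fix c x assume "x \<in> {f. (f, t f) \<in> V}"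
    then show "vscale c x \<in> {f. (f, t f) \<in> V}"
      using pair.subspace_scale[OF assms, of "(x, t x)" c]
      by (simp add: vec_pair.linear_scale[OF t(1)] pscale_def)
  qed
  then have "vec.span B \<subseteq> {f. (f, t f) \<in> V}"
    by (intro vec.span_minimal) (auto simp: s t(2))
  then show ?thesis using B(3) t(1) by blast
qed

text \<open>
  Two right components of the same left component differ by an element of the right contraction.
\<close>

lemma genaut_eq_graph_mod:
  assumes V: "pair.subspace V" and t: "\<And>f. f \<in> restrict_l V \<Longrightarrow> (f, t f) \<in> V"
  shows "V = graph_mod t (restrict_l V) (contract_r V)"
proof -
  have "(f, g) \<in> V \<longleftrightarrow> g - t f \<in> contract_r V" if "f \<in> restrict_l V" for f g
    using pair.subspace_diff[OF V, of "(f, g)" "(f, t f)"]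
      pair.subspace_add[OF V, of "(0, g - t f)" "(f, t f)"] t[OF that]
    by (auto simp: contract_r_def)
  then show ?thesis by (auto simp: graph_mod_def restrict_l_def)
qed

lemma space_on_restrict_l:
  assumes "is_genaut W V"
  shows "space_on W (restrict_l V)"
proof -
  have V: "pair.subspace V" "V \<subseteq> vectors_on W \<times> vectors_on W"
    using assms by (auto simp: is_genaut_def)
  have "vec.subspace (restrict_l V)"
  proof (rule vec.subspaceI)
    show "0 \<in> restrict_l V"
      using pair.subspace_0[OF V(1)] by (auto simp: restrict_l_def zero_prod_def)
  next
    fix x y assume "x \<in> restrict_l V" "y \<in> restrict_l V"
    then show "x + y \<in> restrict_l V"
      using pair.subspace_add[OF V(1)] by (fastforce simp: restrict_l_def)
  next
    fix c x assume "x \<in> restrict_l V"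
    then show "vscale c x \<in> restrict_l V"
      using pair.subspace_scale[OF V(1)] by (fastforce simp: restrict_l_def pscale_def)
  qed
  then show ?thesis using V(2) by (auto simp: space_on_def restrict_l_def)
qed

lemma space_on_contract_r:
  assumes "is_genaut W V"
  shows "space_on W (contract_r V)"
proof -
  have V: "pair.subspace V" "V \<subseteq> vectors_on W \<times> vectors_on W"
    using assms by (auto simp: is_genaut_def)
  have "vec.subspace (contract_r V)"
  proof (rule vec.subspaceI)
    show "0 \<in> contract_r V"
      using pair.subspace_0[OF V(1)] by (auto simp: contract_r_def zero_prod_def)
  next
    fix x y assume "x \<in> contract_r V" "y \<in> contract_r V"
    then show "x + y \<in> contract_r V"
      using pair.subspace_add[OF V(1)] by (fastforce simp: contract_r_def)
  next
    fix c x assume "x \<in> contract_r V"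
    then show "vscale c x \<in> contract_r V"
      using pair.subspace_scale[OF V(1), of "(0, x)" c] by (simp add: contract_r_def pscale_def)
  qed
  then show ?thesis using V(2) by (auto simp: space_on_def contract_r_def)
qed

text \<open>
  The usg half of the genop condition makes \<open>D\<close> stable under the selected map, the lsg half
  makes \<open>K\<close> stable.
\<close>

lemma genop_imp_graph_mod:
  assumes "genop W V"
  obtains t where "induced_operator W t (restrict_l V) (contract_r V)"
    and "V = graph_mod t (restrict_l V) (contract_r V)"
proof -
  have gen: "is_genaut W V" and V: "pair.subspace V"
    and right: "restrict_r V \<subseteq> restrict_l V" and left: "contract_r V \<subseteq> contract_l V"
    using assms by (auto simp: genop_def usg_def lsg_def is_genaut_def)
  obtain t where lin: "Vector_Spaces.linear vscale vscale t"
    and t: "\<And>f. f \<in> restrict_l V \<Longrightarrow> (f, t f) \<in> V"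
    using linear_selection_exists[OF V] by auto
  have KD: "contract_r V \<subseteq> restrict_l V"
    using right by (auto simp: contract_r_def restrict_r_def)
  have tK: "t ` contract_r V \<subseteq> contract_r V"
  proof (rule image_subsetI)
    fix k assume k: "k \<in> contract_r V"
    \<comment> \<open>Both \<open>(k, t k)\<close> and, by the lsg condition, \<open>(k, 0)\<close> lie in \<open>V\<close>.\<close>
    then have "(k, t k) - (k, 0) \<in> V"
      using left KD t by (intro pair.subspace_diff[OF V]) (auto simp: contract_l_def)
    then show "t k \<in> contract_r V" by (simp add: contract_r_def)
  qed
  have tD: "t ` restrict_l V \<subseteq> restrict_l V"
    using t right by (auto simp: restrict_r_def)
  show thesis
  proof (rule that)
    show "induced_operator W t (restrict_l V) (contract_r V)"
      using space_on_restrict_l[OF gen] space_on_contract_r[OF gen] KD lin tD tK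
      by (intro induced_operator.intro)
    show "V = graph_mod t (restrict_l V) (contract_r V)"
      by (rule genaut_eq_graph_mod[OF V t])
  qed
qed

section \<open>Polynomials of a graph modulo a subspace\<close>

lemma dot_add_graph_mod:
  assumes "vec.subspace K"
  shows "dot_add (graph_mod s D K) (graph_mod t D K) = graph_mod (\<lambda>f. s f + t f) D K"
proof (intro equalityI subrelI)
  fix f g assume "(f, g) \<in> dot_add (graph_mod s D K) (graph_mod t D K)"
  then obtain g1 g2 where "f \<in> D" "g1 - s f \<in> K" "g2 - t f \<in> K" "g = g1 + g2"
    by (auto simp: dot_add_def graph_mod_def)
  then show "(f, g) \<in> graph_mod (\<lambda>f. s f + t f) D K"
    using vec.subspace_add[OF assms, of "g1 - s f" "g2 - t f"]
    by (simp add: graph_mod_def add_diff_add)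
next
  fix f g assume "(f, g) \<in> graph_mod (\<lambda>f. s f + t f) D K"
  then have "(f, g - t f) \<in> graph_mod s D K" "(f, t f) \<in> graph_mod t D K"
    using vec.subspace_0[OF assms] by (auto simp: graph_mod_def algebra_simps)
  then have "(f, (g - t f) + t f) \<in> dot_add (graph_mod s D K) (graph_mod t D K)"
    unfolding dot_add_def by blast
  then show "(f, g) \<in> dot_add (graph_mod s D K) (graph_mod t D K)" by simp
qed

context induced_operator
begin

text \<open>
  Scaling by \<open>0\<close> would collapse the right components to \<open>0\<close>; the added right contraction restores
  the indeterminacy \<open>K\<close>.
\<close>

lemma dot_scale_graph_mod:
  "dot_scale c (graph_mod t D K) = graph_mod (\<lambda>f. vscale c (t f)) D K"
proof (intro equalityI subrelI)
  fix f g assume "(f, g) \<in> dot_scale c (graph_mod t D K)"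
  then obtain h k where "f \<in> D" "h - t f \<in> K" "k \<in> K" "g = vscale c h + k"
    unfolding dot_scale_def contract_r_graph_mod
    by (fastforce simp: graph_mod_def elim!: set_plus_elim)
  then show "(f, g) \<in> graph_mod (\<lambda>f. vscale c (t f)) D K"
    using vec.subspace_add[OF subspace_K vec.subspace_scale[OF subspace_K, of "h - t f" c], of k]
    by (simp add: graph_mod_def vec.scale_right_diff_distrib algebra_simps)
next
  fix f g assume fg: "(f, g) \<in> graph_mod (\<lambda>f. vscale c (t f)) D K"
  then have "(f, t f) \<in> graph_mod t D K" "g - vscale c (t f) \<in> K"
    using vec.subspace_0[OF subspace_K] by (auto simp: graph_mod_def)
  then have "(f, vscale c (t f)) + (0, g - vscale c (t f)) \<in> dot_scale c (graph_mod t D K)"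
    unfolding dot_scale_def contract_r_graph_mod by (intro set_plus_intro) auto
  then show "(f, g) \<in> dot_scale c (graph_mod t D K)" by simp
qed

text \<open>
  The intermediate vector is fixed only up to \<open>K\<close>.  This ambiguity disappears in the result because
  \<open>t\<close> maps \<open>K\<close> into itself.
\<close>

lemma genaut_mult_graph_mod:
  assumes "s ` D \<subseteq> D"
  shows "genaut_mult (graph_mod s D K) (graph_mod t D K) = graph_mod (t \<circ> s) D K"
proof (intro equalityI subrelI)
  fix f h assume "(f, h) \<in> genaut_mult (graph_mod s D K) (graph_mod t D K)"
  then obtain g where g: "f \<in> D" "g - s f \<in> K" "h - t g \<in> K"
    by (auto simp: genaut_mult_def matched_def graph_mod_def)
  then have "t (g - s f) \<in> K" using t_K by auto
  then have "(h - t g) + t (g - s f) \<in> K"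
    using g(3) vec.subspace_add[OF subspace_K] by blast
  then show "(f, h) \<in> graph_mod (t \<circ> s) D K"
    using g(1) by (simp add: graph_mod_def vec_pair.linear_diff[OF linear_t])
next
  fix f h assume "(f, h) \<in> graph_mod (t \<circ> s) D K"
  then have "(f, s f) \<in> graph_mod s D K" "(s f, h) \<in> graph_mod t D K"
    using vec.subspace_0[OF subspace_K] assms by (auto simp: graph_mod_def)
  then show "(f, h) \<in> genaut_mult (graph_mod s D K) (graph_mod t D K)"
    by (auto simp: genaut_mult_def matched_def)
qed

lemma genaut_power_0_graph_mod: "genaut_power W (graph_mod t D K) 0 = graph_mod id D K"
proof (intro equalityI subrelI)
  fix f g assume "(f, g) \<in> genaut_power W (graph_mod t D K) 0"
  then show "(f, g) \<in> graph_mod id D K"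
    unfolding genaut_power.simps restrict_l_graph_mod contract_r_graph_mod
    by (auto simp: dot_add_def genaut_id_def graph_mod_def)
next
  fix f g assume "(f, g) \<in> graph_mod id D K"
  then have "(f, f) \<in> genaut_id W" "(f, g - f) \<in> D \<times> K"
    using space_D by (auto simp: graph_mod_def genaut_id_def space_on_def)
  then have "(f, f + (g - f)) \<in> dot_add (genaut_id W) (D \<times> K)"
    unfolding dot_add_def by blast
  then show "(f, g) \<in> genaut_power W (graph_mod t D K) 0"
    by (simp add: restrict_l_graph_mod contract_r_graph_mod)
qed

lemma genaut_power_Suc_graph_mod:
  "genaut_power W (graph_mod t D K) (Suc n) = graph_mod (t ^^ Suc n) D K"
proof (induction n)
  case 0
  show ?case by simp
next
  case (Suc n)
  then show ?case
    using genaut_mult_graph_mod[OF funpow_image_subset[OF t_D, of "Suc n"]]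
    by (simp only: genaut_power.simps funpow.simps(2))
qed

text \<open>
  The two lemmas above have to be separate: the first power is a base case of the recursion, not a
  product with the zeroth power.
\<close>

lemma genaut_power_graph_mod: "genaut_power W (graph_mod t D K) n = graph_mod (t ^^ n) D K"
  by (cases n)
    (simp_all only: genaut_power_0_graph_mod genaut_power_Suc_graph_mod funpow.simps(1))

text \<open>
  Every summand is a graph on the same \<open>D\<close> modulo the same \<open>K\<close>, so the right components simply add
  up; a zero coefficient contributes \<open>D \<times> K\<close>, the graph of the zero operator.
\<close>

lemma genaut_poly_graph_mod: "genaut_poly W p (graph_mod t D K) = graph_mod (poly_op p t) D K"
proof -
  have scaled_power: "dot_scale c (genaut_power W (graph_mod t D K) n) =
      graph_mod (\<lambda>f. vscale c ((t ^^ n) f)) D K" for c n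
    using induced_operator.dot_scale_graph_mod[OF induced_operator_funpow]
    by (simp only: genaut_power_graph_mod)
  have "genaut_poly_upto W p (graph_mod t D K) n =
      graph_mod (\<lambda>f. \<Sum>i\<le>n. vscale (coeff p i) ((t ^^ i) f)) D K" for n
  proof (induction n)
    case 0
    show ?case by (simp only: genaut_poly_upto.simps scaled_power) simp
  next
    case (Suc n)
    then show ?case
      by (simp only: genaut_poly_upto.simps scaled_power dot_add_graph_mod[OF subspace_K] sum.atMost_Suc)
  qed
  then show ?thesis
    by (simp add: genaut_poly_def poly_op_def[abs_def])
qed

end

section \<open>Invariant subspaces and the induced operators on \<open>D / U\<close> and \<open>U / K\<close>\<close>

text \<open>
  The chain \<open>K \<subseteq> U \<subseteq> D\<close> with \<open>U\<close> mapped into itself is what invariance of \<open>U\<close> amounts to.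
\<close>

locale invariant_chain = induced_operator +
  fixes U
  assumes space_U: "space_on W U"
    and K_subset_U: "K \<subseteq> U"
    and U_subset_D: "U \<subseteq> D"
    and t_U: "t ` U \<subseteq> U"
begin

lemma subspace_U: "vec.subspace U"
  using space_U by (simp add: space_on_def)

lemma induced_operator_quotient: "induced_operator W t D U"
  using space_D space_U U_subset_D linear_t t_D t_U by (intro induced_operator.intro)

lemma induced_operator_subspace: "induced_operator W t U K"
  using space_K space_U K_subset_U linear_t t_K t_U by (intro induced_operator.intro)

lemma invariant_chain_poly_op: "invariant_chain W (poly_op p t) D K U"
  using induced_operator_poly_op space_U K_subset_U U_subset_D
    poly_op_image_subset[OF subspace_U t_U]
  by (intro invariant_chain.intro invariant_chain_axioms.intro)

lemma graph_mod_right_in_U: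
  assumes "(f, g) \<in> graph_mod t D K" "f \<in> U"
  shows "g \<in> U"
proof -
  have "(g - t f) + t f \<in> U"
    using assms t_U K_subset_U by (intro vec.subspace_add[OF subspace_U]) (auto simp: graph_mod_def)
  then show ?thesis by simp
qed

text \<open>
  Adding \<open>U\<close> on the left does not enlarge \<open>D\<close> and shifts the right component by \<open>t u \<in> U\<close>, which
  \<open>U\<close> on the right absorbs.
\<close>

lemma graph_mod_plus_square: "graph_mod t D K + U \<times> U = graph_mod t D U"
proof (intro equalityI subrelI)
  fix f g assume "(f, g) \<in> graph_mod t D K + U \<times> U"
  then obtain f1 g1 u v where *: "f1 \<in> D" "g1 - t f1 \<in> K" "u \<in> U" "v \<in> U"
    "f = f1 + u" "g = g1 + v"
    by (auto simp: graph_mod_def elim!: set_plus_elim)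
  have "(g1 - t f1) + (v - t u) \<in> U"
  proof (rule vec.subspace_add[OF subspace_U])
    show "g1 - t f1 \<in> U" using * K_subset_U by auto
    show "v - t u \<in> U" using * t_U by (intro vec.subspace_diff[OF subspace_U]) auto
  qed
  moreover have "f1 + u \<in> D"
    using * U_subset_D by (intro vec.subspace_add[OF subspace_D]) auto
  ultimately show "(f, g) \<in> graph_mod t D U"
    using * by (simp add: graph_mod_def vec_pair.linear_add[OF linear_t] add_diff_add)
next
  fix f g assume "(f, g) \<in> graph_mod t D U"
  then have "(f, t f) \<in> graph_mod t D K" "(0, g - t f) \<in> U \<times> U"
    using vec.subspace_0[OF subspace_K] vec.subspace_0[OF subspace_U]
    by (auto simp: graph_mod_def)
  from set_plus_intro[OF this] show "(f, g) \<in> graph_mod t D K + U \<times> U" by simp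
qed

lemma inter_l_graph_mod: "inter_l (graph_mod t D K) U = graph_mod t U K"
  using U_subset_D by (auto simp: inter_l_def graph_mod_def)

lemma inter_l_eq_inter_square: "inter_l (graph_mod t D K) U = graph_mod t D K \<inter> (U \<times> U)"
  using graph_mod_right_in_U by (auto simp: inter_l_def)

lemma invariant_in_graph_mod: "invariant_in U (graph_mod t D K)"
proof -
  have "U \<subseteq> matched_r (graph_mod t D K) U"
  proof
    fix f assume f: "f \<in> U"
    then have "(f, t f) \<in> graph_mod t D K" "t f \<in> U"
      using U_subset_D t_U vec.subspace_0[OF subspace_K] by (auto simp: graph_mod_def)
    then show "f \<in> matched_r (graph_mod t D K) U" by (auto simp: matched_r_def)
  qed
  then show ?thesis
    using graph_mod_right_in_U
    by (auto simp: invariant_in_def conditioned_invariant_def controlled_invariant_def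
        matched_l_def)
qed

end

lemma invariant_in_subset_restrict_l: "invariant_in U V \<Longrightarrow> U \<subseteq> restrict_l V"
  by (auto simp: invariant_in_def controlled_invariant_def matched_r_def restrict_l_def)

lemma invariant_in_right_in: "invariant_in U V \<Longrightarrow> (f, g) \<in> V \<Longrightarrow> f \<in> U \<Longrightarrow> g \<in> U"
  by (auto simp: invariant_in_def conditioned_invariant_def matched_l_def)

text \<open>
  A right component over a fixed left component is determined up to the right contraction of \<open>Vu\<close>,
  which lies in every conditioned invariant space.  Adding \<open>U\<close> on the right therefore hides the
  difference between \<open>Vu\<close> and the smaller \<open>V\<close>.
\<close>

lemma sum_r_eq_plus_square:
  assumes Vu: "pair.subspace Vu" and U: "vec.subspace U"
    and sub: "V \<subseteq> Vu" and restr: "restrict_l V = restrict_l Vu"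
    and inv: "invariant_in U Vu"
  shows "sum_r Vu U = V + U \<times> U"
proof (intro equalityI subrelI)
  fix f g assume "(f, g) \<in> sum_r Vu U"
  then obtain h u where h: "(f, h) \<in> Vu" "u \<in> U" "g = h + u"
    by (auto simp: sum_r_def elim!: set_plus_elim)
  then obtain h' where h': "(f, h') \<in> V"
    using restr by (auto simp: restrict_l_def)
  have "(0, h - h') \<in> Vu"
    using pair.subspace_diff[OF Vu h(1), of "(f, h')"] h' sub by auto
  then have "(0, h - h' + u) \<in> U \<times> U"
    using invariant_in_right_in[OF inv] vec.subspace_0[OF U] vec.subspace_add[OF U] h(2) by auto
  from set_plus_intro[OF h' this] show "(f, g) \<in> V + U \<times> U"
    using h(3) by (simp add: add.assoc[symmetric])
next
  fix f g assume "(f, g) \<in> V + U \<times> U"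
  then obtain f1 g1 u v where *: "(f1, g1) \<in> V" "u \<in> U" "v \<in> U" "f = f1 + u" "g = g1 + v"
    by (auto elim!: set_plus_elim)
  obtain w where w: "(u, w) \<in> Vu" "w \<in> U"
    using inv *(2) by (auto simp: invariant_in_def controlled_invariant_def matched_r_def)
  have "(f, g1 + w) \<in> Vu"
    using pair.subspace_add[OF Vu _ w(1), of "(f1, g1)"] * sub by auto
  moreover have "(0, v - w) \<in> {0} \<times> U"
    using vec.subspace_diff[OF U *(3) w(2)] by simp
  ultimately have "(f, g1 + w) + (0, v - w) \<in> sum_r Vu U"
    unfolding sum_r_def by (rule set_plus_intro)
  then show "(f, g) \<in> sum_r Vu U" using * by simp
qed

theorem theorem51:
  fixes W :: "'w set"
    and Vu V :: "('w, 'a::field) genaut"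
    and U :: "('w \<Rightarrow> 'a) set"
    and p p1 p2 :: "'a poly"
  assumes "finite W"
    and "usg W Vu"
    and "genop W V"
    and "V \<subseteq> Vu"
    and "restrict_l V = restrict_l Vu"
    and "space_on W U"
    and "invariant_in U Vu"
  shows "(sum_r Vu U = V + U \<times> U \<and> genop W (sum_r Vu U)) \<and>
    (invariant_in U V \<and> inter_l V U = V \<inter> (U \<times> U) \<and> genop W (inter_l V U)) \<and>
    genaut_poly W p (sum_r Vu U) = genaut_poly W p V + U \<times> U \<and>
    (genaut_poly W p (inter_l V U) = inter_l (genaut_poly W p V) U \<and>
      inter_l (genaut_poly W p V) U = genaut_poly W p V \<inter> (U \<times> U)) \<and>
    (decoupled W (genaut_poly W p V) \<longrightarrow>
      decoupled W (genaut_poly W p (sum_r Vu U)) \<and>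
      decoupled W (genaut_poly W p (inter_l V U))) \<and>
    (decoupled W (genaut_poly W p1 (sum_r Vu U)) \<and>
      decoupled W (genaut_poly W p2 (inter_l V U)) \<longrightarrow>
      decoupled W (genaut_poly W (p1 * p2) V))"
proof -
  define D where "D = restrict_l V"
  define K where "K = contract_r V"
  have Vu: "pair.subspace Vu"
    using assms(2) by (simp add: usg_def is_genaut_def)
  obtain t where t: "induced_operator W t D K" and V: "V = graph_mod t D K"
    using genop_imp_graph_mod[OF assms(3)] unfolding D_def K_def by blast
  interpret induced_operator W t D K by (fact t)
  have right_U: "g \<in> U" if "(f, g) \<in> V" "f \<in> U" for f g
    using invariant_in_right_in[OF assms(7)] that assms(4) by blast
  have U: "vec.subspace U" using assms(6) by (simp add: space_on_def)
  have KU: "K \<subseteq> U"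
    using right_U vec.subspace_0[OF U] by (auto simp: K_def contract_r_def)
  have UD: "U \<subseteq> D"
    using invariant_in_subset_restrict_l[OF assms(7)] assms(5) by (simp add: D_def)
  have tU: "t ` U \<subseteq> U"
  proof (rule image_subsetI)
    fix f assume f: "f \<in> U"
    then have "(f, t f) \<in> V"
      using UD vec.subspace_0[OF subspace_K] by (auto simp: V graph_mod_def)
    then show "t f \<in> U" using right_U f by blast
  qed
  interpret invariant_chain W t D K U
    using assms(6) KU UD tU by unfold_locales
  interpret quotient: induced_operator W t D U by (fact induced_operator_quotient)
  interpret subsp: induced_operator W t U K by (fact induced_operator_subspace)

  have sum_V: "sum_r Vu U = V + U \<times> U"
    by (rule sum_r_eq_plus_square[OF Vu U assms(4,5,7)])
  have sum_graph: "sum_r Vu U = graph_mod t D U"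
    unfolding sum_V V by (rule graph_mod_plus_square)
  have inter_graph: "inter_l V U = graph_mod t U K"
    unfolding V by (rule inter_l_graph_mod)
  have poly_V: "genaut_poly W q V = graph_mod (poly_op q t) D K" for q
    unfolding V by (rule genaut_poly_graph_mod)
  have poly_sum: "genaut_poly W q (sum_r Vu U) = graph_mod (poly_op q t) D U" for q
    unfolding sum_graph by (rule quotient.genaut_poly_graph_mod)
  have poly_inter: "genaut_poly W q (inter_l V U) = graph_mod (poly_op q t) U K" for q
    unfolding inter_graph by (rule subsp.genaut_poly_graph_mod)
  have dec_V: "decoupled W (genaut_poly W q V) \<longleftrightarrow> poly_op q t ` D \<subseteq> K" for q
    unfolding poly_V by (rule induced_operator.decoupled_graph_mod_iff[OF induced_operator_poly_op])
  have dec_sum: "decoupled W (genaut_poly W q (sum_r Vu U)) \<longleftrightarrow> poly_op q t ` D \<subseteq> U" for q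
    unfolding poly_sum
    by (rule induced_operator.decoupled_graph_mod_iff[OF quotient.induced_operator_poly_op])
  have dec_inter: "decoupled W (genaut_poly W q (inter_l V U)) \<longleftrightarrow> poly_op q t ` U \<subseteq> K" for q
    unfolding poly_inter
    by (rule induced_operator.decoupled_graph_mod_iff[OF subsp.induced_operator_poly_op])

  show ?thesis
  proof (intro conjI impI)
    show "sum_r Vu U = V + U \<times> U" by (fact sum_V)
    show "genop W (sum_r Vu U)" unfolding sum_graph by (rule quotient.genop_graph_mod)
    show "invariant_in U V" unfolding V by (rule invariant_in_graph_mod)
    show "inter_l V U = V \<inter> (U \<times> U)" unfolding V by (rule inter_l_eq_inter_square)
    show "genop W (inter_l V U)" unfolding inter_graph by (rule subsp.genop_graph_mod)
    show "genaut_poly W p (sum_r Vu U) = genaut_poly W p V + U \<times> U"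
      unfolding poly_sum poly_V
      by (rule invariant_chain.graph_mod_plus_square[OF invariant_chain_poly_op, symmetric])
    show "genaut_poly W p (inter_l V U) = inter_l (genaut_poly W p V) U"
      unfolding poly_inter poly_V
      by (rule invariant_chain.inter_l_graph_mod[OF invariant_chain_poly_op, symmetric])
    show "inter_l (genaut_poly W p V) U = genaut_poly W p V \<inter> (U \<times> U)"
      unfolding poly_V
      by (rule invariant_chain.inter_l_eq_inter_square[OF invariant_chain_poly_op])
  next
    assume "decoupled W (genaut_poly W p V)"
    then show "decoupled W (genaut_poly W p (sum_r Vu U))"
      and "decoupled W (genaut_poly W p (inter_l V U))"
      unfolding dec_V dec_sum dec_inter using K_subset_U U_subset_D by auto
  next
    assume "decoupled W (genaut_poly W p1 (sum_r Vu U)) \<and>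
      decoupled W (genaut_poly W p2 (inter_l V U))"
    then have "poly_op p1 t ` D \<subseteq> U" "poly_op p2 t ` U \<subseteq> K"
      unfolding dec_sum dec_inter by auto
    \<comment> \<open>Polynomials in \<open>t\<close> commute, so \<open>p1(t)\<close> can be applied first.\<close>
    moreover have "poly_op (p1 * p2) t f = poly_op p2 t (poly_op p1 t f)" for f
      by (subst mult.commute) (rule poly_op_mult[OF linear_t])
    ultimately show "decoupled W (genaut_poly W (p1 * p2) V)"
      unfolding dec_V by auto
  qed
qed

end
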